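(* Let $X$ be a scalar Gaussian random variable with zero mean value and variance $\sigma^2$. Given $n\in\mathbb{N}$, let $g:\mathbb{R}\to\mathbb{R}$ be a $C^n$ function for which the averages $\mathbb{E}\left[g(X)X^n\right]$ and $\mathbb{E}\left[g^{(n-2k)}(X)\right]$, for $k=0,\ldots,\lfloor n/2\rfloor$, exist. Then $$\mathbb{E}\left[g(X)X^n\right]=\sum_{k=0}^{\lfloor n/2\rfloor}H_{n,k}\,\sigma^{2(n-k)}\,\mathbb{E}\left[g^{(n-2k)}(X)\right],$$ where $$H_{n,k}=\frac{n!}{2^k\,k!\,(n-2k)!},\qquad k=0,\ldots,\lfloor n/2\rfloor,$$ are the absolute values of the coefficients appearing in the $n$th-order probabilist's Hermite polynomial $He_n(x)=\sum_{k=0}^{\lfloor n/2\rfloor}(-1)^kH_{n,k}x^{n-2k}$.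
   Context: $\mathbb{E}[\cdot]$ is the mean value (expectation) operator. $X$ has density $f(x)=\left(\sigma\sqrt{2\pi}\right)^{-1}\exp\left(-x^2/(2\sigma^2)\right)$ on $\mathbb{R}$. $g^{(\ell)}$ denotes the $\ell$th derivative of $g$, with $g^{(0)}:=g$, and $\lfloor\cdot\rfloor$ is the floor function. An average $\mathbb{E}[h(X)]$ exists when $h(X)$ is integrable. *)

theory Defs
  imports "HOL-Probability.Probability" "HOL-Computational_Algebra.Polynomial"
begin

text \<open>Lower derivatives need no separate continuity clause: they are differentiable, hence continuous.\<close>

definition C_n :: "nat \<Rightarrow> (real \<Rightarrow> real) \<Rightarrow> bool" where
  "C_n n g \<longleftrightarrow>
     (\<forall>k<n. (deriv ^^ k) g differentiable_on UNIV) \<and> continuous_on UNIV ((deriv ^^ n) g)"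

definition H :: "nat \<Rightarrow> nat \<Rightarrow> real" where
  "H n k = fact n / (2 ^ k * fact k * fact (n - 2 * k))"

fun He :: "nat \<Rightarrow> real poly" where
  "He 0 = 1"
| "He (Suc n) = [:0, 1:] * He n - pderiv (He n)"

text \<open>The recursion agrees with Rodrigues' formula for the probabilist's Hermite polynomials.\<close>

lemma higher_deriv_gauss:
  "(deriv ^^ n) (\<lambda>x::real. exp (- (x\<^sup>2 / 2))) = (\<lambda>x. (-1) ^ n * poly (He n) x * exp (- (x\<^sup>2 / 2)))"
proof (induction n)
  case (Suc n)
  have "((\<lambda>x. (-1) ^ n * poly (He n) x * exp (- (x\<^sup>2 / 2))) has_field_derivative
      (-1) ^ Suc n * poly (He (Suc n)) x * exp (- (x\<^sup>2 / 2))) (at x)" for x :: real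
    by (auto intro!: derivative_eq_intros simp: algebra_simps)
  then have "deriv (\<lambda>x. (-1) ^ n * poly (He n) x * exp (- (x\<^sup>2 / 2))) x =
      (-1) ^ Suc n * poly (He (Suc n)) x * exp (- (x\<^sup>2 / 2))" for x :: real
    by (rule DERIV_imp_deriv)
  then show ?case
    by (simp only: funpow.simps comp_apply Suc.IH)
qed simp

lemma He_Rodrigues:
  "poly (He n) x = (-1) ^ n * exp (x\<^sup>2 / 2) * (deriv ^^ n) (\<lambda>x::real. exp (- (x\<^sup>2 / 2))) x"
  unfolding higher_deriv_gauss
  by (simp add: exp_minus field_simps flip: power_mult_distrib)

end

theory Submission
  imports Defs "HOL-Real_Asymp.Real_Asymp"
begin

text \<open>
  Everything rests on Stein's identity $E[X f(X)] = \sigma^2 E[f'(X)]$, in a strong form: the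
  integrability of $f'(X)$ alone already forces $X f(X)$ to be integrable. The reason is that
  $x \varphi(x)$ is $-\sigma^2$ times the derivative of the Gaussian density $\varphi$. Writing
  $f(x) - f(0)$ as the integral of $f'$ from $0$ to $x$ and exchanging the two integrations, the
  mass that $|x| \varphi(x)$ puts beyond a point $t$ (on the side away from $0$) is exactly
  $\sigma^2 \varphi(t)$; this is \<open>gauss_stein\<close>. Fubini's theorem thus takes the place of an
  integration by parts, whose boundary terms would need decay of $f$ at infinity.

  Applied to $x^k f(x)$, Stein's identity trades one power of $X$ for one derivative,
  \[ E[X^{k+1} f(X)] = \sigma^2 (E[X^k f'(X)] + k E[X^{k-1} f(X)]), \]
  and again the integrability on the left is a consequence of that of $X^k f'(X)$
  (\<open>gauss_stein_power\<close>). Since lowering a power of $X$ never destroys integrability of a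
  continuous function, an induction on $n$ starting from $E[g^{(n)}(X)]$ produces all the mixed
  moments that occur, including those whose derivative order has the wrong parity to appear in the
  formula.

  With $f = g$ and $k = n + 1$ the display becomes a recursion for $E[X^{n+2} g(X)]$ in terms of
  $E[X^{n+1} g'(X)]$ and $E[X^n g(X)]$. The sums on the right-hand side of the theorem satisfy the
  same recursion because $H_{n+2,k} = H_{n+1,k} + (n+1) H_{n,k-1}$. Up to the alternating signs this
  is the three-term recurrence $He_{n+2} = x\,He_{n+1} - (n+1) He_n$, so a single summation lemma,
  \<open>hermite_sum_rec\<close>, yields both the moment formula and the explicit form of the Hermite
  polynomials.
\<close>

section \<open>The Hermite coefficients\<close>

lemma H_0 [simp]: "H n 0 = 1"
  by (simp add: H_def)

lemma H_Suc_Suc: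
  assumes "2 * k + 1 \<le> n"
  shows "H (Suc (Suc n)) (Suc k) = H (Suc n) (Suc k) + real (Suc n) * H n k"
proof -
  obtain m where n: "n = Suc m + 2 * k"
    using assms by (metis Suc_eq_plus1 add.commute add_Suc le_Suc_ex)
  have eqs: "Suc (Suc n) - 2 * Suc k = Suc m" "Suc n - 2 * Suc k = m" "n - 2 * k = Suc m"
    by (auto simp: n)
  define F where "F = (fact (Suc n) :: real)"
  define D where "D = (2 ^ Suc k * fact (Suc k) * fact (Suc m) :: real)"
  have D: "D \<noteq> 0" by (simp add: D_def)
  have "H (Suc (Suc n)) (Suc k) = real (Suc (Suc n)) * F / D"
    unfolding H_def eqs F_def D_def by simp
  moreover have "H (Suc n) (Suc k) = real (Suc m) * F / D"
    unfolding H_def eqs F_def D_def by (simp del: of_nat_Suc power_Suc add: field_simps)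
  moreover have "real (Suc n) * H n k = (2 * real (Suc k)) * F / D"
    unfolding H_def eqs F_def D_def by (simp del: of_nat_Suc add: field_simps)
  moreover have "real (Suc (Suc n)) = real (Suc m) + 2 * real (Suc k)"
    by (simp add: n)
  ultimately show ?thesis
    by (simp only: add_divide_distrib distrib_right)
qed

text \<open>
  At the top index $k + 1$ for even $n = 2k$ the coefficient $H_{n+1,k+1}$ is zero as a Hermite
  coefficient, but \<open>H\<close>, read with truncated subtraction, is not; hence a separate recurrence.
\<close>

lemma H_even_top: "H (Suc (Suc (2 * k))) (Suc k) = real (Suc (2 * k)) * H (2 * k) k"
proof -
  have "real (Suc (Suc (2 * k))) = 2 * real (Suc k)" by simp
  then have "H (Suc (Suc (2 * k))) (Suc k) =
      (2 * real (Suc k)) * (real (Suc (2 * k)) * fact (2 * k)) / ((2 * real (Suc k)) * (2 ^ k * fact k))"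
    unfolding H_def fact_Suc power_Suc by (simp del: of_nat_Suc add: ac_simps)
  then show ?thesis
    by (simp del: of_nat_Suc add: H_def)
qed

text \<open>
  Setting the coefficients to zero beyond $k = \lfloor n/2 \rfloor$ makes
  $H_{n+2,k} = H_{n+1,k} + (n+1) H_{n,k-1}$ valid for all $k$, which removes the dependence of the
  summation range on the parity of $n$. The sequence \<open>a\<close> is left arbitrary so that the lemma
  serves for powers of $x$ and for moments alike.
\<close>

lemma hermite_sum_rec:
  fixes a :: "nat \<Rightarrow> real"
  shows "(\<Sum>k = 0..Suc (Suc n) div 2. H (Suc (Suc n)) k * a k) =
         (\<Sum>k = 0..Suc n div 2. H (Suc n) k * a k) +
         real (Suc n) * (\<Sum>k = 0..n div 2. H n k * a (Suc k))"
proof -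
  define h where "h m k = (if 2 * k \<le> m then H m k else 0)" for m k
  have ext: "(\<Sum>k = 0..m div 2. H m k * b k) = (\<Sum>k\<le>N. h m k * b k)" if "m div 2 \<le> N"
    for m N and b :: "nat \<Rightarrow> real"
    using that by (intro sum.mono_neutral_cong_left) (auto simp: h_def)
  have rec: "h (Suc (Suc n)) (Suc k) = h (Suc n) (Suc k) + real (Suc n) * h n k" for k
  proof -
    consider "2 * k + 1 \<le> n" | "n = 2 * k" | "n < 2 * k" by linarith
    then show ?thesis
      by cases (auto simp: h_def H_Suc_Suc H_even_top simp del: of_nat_Suc)
  qed
  have "(\<Sum>k = 0..Suc (Suc n) div 2. H (Suc (Suc n)) k * a k) =
        (\<Sum>k\<le>Suc n. h (Suc (Suc n)) k * a k)"
    by (rule ext) simp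
  also have "\<dots> = h (Suc n) 0 * a 0 + (\<Sum>k\<le>n. h (Suc n) (Suc k) * a (Suc k)) +
                 real (Suc n) * (\<Sum>k\<le>n. h n k * a (Suc k))"
    unfolding sum.atMost_Suc_shift rec
    by (simp add: h_def[of _ 0] distrib_right sum.distrib sum_distrib_left mult.assoc del: of_nat_Suc)
  also have "h (Suc n) 0 * a 0 + (\<Sum>k\<le>n. h (Suc n) (Suc k) * a (Suc k)) =
             (\<Sum>k = 0..Suc n div 2. H (Suc n) k * a k)"
    by (subst ext[of _ "Suc n"]) (simp_all add: sum.atMost_Suc_shift del: sum.atMost_Suc)
  also have "(\<Sum>k\<le>n. h n k * a (Suc k)) = (\<Sum>k = 0..n div 2. H n k * a (Suc k))"
    by (rule ext[symmetric]) simp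
  finally show ?thesis .
qed

lemma pderiv_He_Suc: "pderiv (He (Suc n)) = smult (of_nat (Suc n)) (He n)"
proof (induction n)
  case 0
  show ?case by (simp add: pderiv_pCons)
next
  case (Suc n)
  have "pderiv (He (Suc (Suc n))) =
        He (Suc n) + [:0, 1:] * pderiv (He (Suc n)) - pderiv (pderiv (He (Suc n)))"
    by (simp only: He.simps(2)[of "Suc n"] pderiv_diff pderiv_mult) (simp add: pderiv_pCons)
  also have "\<dots> = He (Suc n) + smult (of_nat (Suc n)) ([:0, 1:] * He n - pderiv (He n))"
    unfolding Suc.IH by (simp only: pderiv_smult smult_diff_right mult_smult_right)
  also have "\<dots> = smult (of_nat (Suc (Suc n))) (He (Suc n))"
    by (simp only: He.simps(2)[symmetric] of_nat_Suc[of "Suc n"] smult_add_left smult_1_left)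
  finally show ?case .
qed

lemma poly_He: "poly (He n) x = (\<Sum>k = 0..n div 2. (-1) ^ k * H n k * x ^ (n - 2 * k))"
proof (induction n rule: induct_nat_012)
  case (ge2 n)
  have "(\<Sum>k = 0..Suc (Suc n) div 2. (-1) ^ k * H (Suc (Suc n)) k * x ^ (Suc (Suc n) - 2 * k)) =
        (\<Sum>k = 0..Suc (Suc n) div 2. H (Suc (Suc n)) k * ((-1) ^ k * x ^ (Suc (Suc n) - 2 * k)))"
    by (simp add: ac_simps)
  also have "\<dots> = (\<Sum>k = 0..Suc n div 2. H (Suc n) k * ((-1) ^ k * x ^ (Suc (Suc n) - 2 * k))) +
      real (Suc n) * (\<Sum>k = 0..n div 2. H n k * ((-1) ^ Suc k * x ^ (Suc (Suc n) - 2 * Suc k)))"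
    by (rule hermite_sum_rec)
  also have "(\<Sum>k = 0..Suc n div 2. H (Suc n) k * ((-1) ^ k * x ^ (Suc (Suc n) - 2 * k))) =
             x * poly (He (Suc n)) x"
    unfolding ge2.IH(2) sum_distrib_left
    by (intro sum.cong refl) (auto simp: Suc_diff_le)
  also have "(\<Sum>k = 0..n div 2. H n k * ((-1) ^ Suc k * x ^ (Suc (Suc n) - 2 * Suc k))) =
             - poly (He n) x"
    unfolding ge2.IH(1) sum_negf[symmetric]
    by (intro sum.cong refl) auto
  also have "x * poly (He (Suc n)) x + real (Suc n) * - poly (He n) x =
             poly (He (Suc (Suc n))) x"
    by (simp only: He.simps(2)[of "Suc n"] pderiv_He_Suc) simp
  finally show ?case ..
qed auto

lemma coeff_He:
  assumes "k \<le> n div 2"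
  shows "coeff (He n) (n - 2 * k) = (-1) ^ k * H n k"
proof -
  have "He n = (\<Sum>j = 0..n div 2. monom ((-1) ^ j * H n j) (n - 2 * j))"
    by (intro poly_eq_poly_eq_iff[THEN iffD1] ext) (simp add: poly_He poly_sum poly_monom)
  then have "coeff (He n) (n - 2 * k) =
      (\<Sum>j = 0..n div 2. if n - 2 * j = n - 2 * k then (-1) ^ j * H n j else 0)"
    by (simp add: coeff_sum)
  also have "\<dots> = (\<Sum>j = 0..n div 2. if j = k then (-1) ^ j * H n j else 0)"
    using assms by (intro sum.cong refl) auto
  finally show ?thesis
    using assms by simp
qed

section \<open>Stein's identity by Fubini's theorem\<close>

lemma normal_density_has_real_derivative:
  assumes "\<sigma> > 0"
  shows "((\<lambda>x. - (\<sigma>\<^sup>2 * normal_density 0 \<sigma> x)) has_real_derivative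
          x * normal_density 0 \<sigma> x) (at x)"
  unfolding normal_density_def using assms
  by (auto intro!: derivative_eq_intros simp: field_simps power2_eq_square)

lemma normal_density_tendsto_0:
  assumes "\<sigma> > 0"
  shows "(normal_density 0 \<sigma> \<longlongrightarrow> 0) at_top"
  unfolding normal_density_def using assms by real_asymp

lemma normal_density_tail_moment:
  assumes "\<sigma> > 0" "t \<ge> 0"
  shows "has_bochner_integral lborel
           (\<lambda>x. x * normal_density 0 \<sigma> x * indicator {t..} x) (\<sigma>\<^sup>2 * normal_density 0 \<sigma> t)"
proof (rule has_bochner_integral_nn_integral)
  have "(\<integral>\<^sup>+x. ennreal (x * normal_density 0 \<sigma> x) * indicator {t..} x \<partial>lborel) =
        ennreal (0 - - (\<sigma>\<^sup>2 * normal_density 0 \<sigma> t))"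
  proof (rule nn_integral_FTC_atLeast)
    show "((\<lambda>x. - (\<sigma>\<^sup>2 * normal_density 0 \<sigma> x)) \<longlongrightarrow> 0) at_top"
      using tendsto_minus[OF tendsto_mult_right_zero[OF normal_density_tendsto_0[OF assms(1)], of "\<sigma>\<^sup>2"]]
      by simp
  qed (use assms in \<open>auto intro: normal_density_has_real_derivative\<close>)
  then show "(\<integral>\<^sup>+x. ennreal (x * normal_density 0 \<sigma> x * indicator {t..} x) \<partial>lborel) =
             ennreal (\<sigma>\<^sup>2 * normal_density 0 \<sigma> t)"
    by (simp add: indicator_mult_ennreal mult.commute)
qed (use assms in \<open>auto split: split_indicator\<close>)

text \<open>
  The points lying beyond \<open>t\<close> as seen from the origin. For \<open>t = 0\<close> only the right half-line
  is taken; with both half-lines, \<open>normal_density_mass_beyond\<close> would give twice the value at \<open>t = 0\<close>.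
\<close>

definition beyond :: "real \<Rightarrow> real set" where
  "beyond t = (if 0 \<le> t then {t..} else {..t})"

lemma indicator_beyond:
  "indicator (beyond t) x = (if 0 \<le> t \<and> t \<le> x \<or> t < 0 \<and> x \<le> t then 1 else 0)"
  by (auto simp: beyond_def)

lemma normal_density_mass_beyond:
  assumes "\<sigma> > 0"
  shows "has_bochner_integral lborel
           (\<lambda>x. normal_density 0 \<sigma> x * \<bar>x\<bar> * indicator (beyond t) x) (\<sigma>\<^sup>2 * normal_density 0 \<sigma> t)"
proof (cases "0 \<le> t")
  case True
  have "(\<lambda>x. normal_density 0 \<sigma> x * \<bar>x\<bar> * indicator (beyond t) x) =
        (\<lambda>x. x * normal_density 0 \<sigma> x * indicator {t..} x)"
    using True by (auto simp: beyond_def split: split_indicator)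
  then show ?thesis
    using normal_density_tail_moment[OF assms True] by simp
next
  case False
  have even: "normal_density 0 \<sigma> (- x) = normal_density 0 \<sigma> x" for x
    by (simp add: normal_density_def)
  then have "(\<lambda>x. normal_density 0 \<sigma> (0 + -1 * x) * \<bar>0 + -1 * x\<bar> *
          indicator (beyond t) (0 + -1 * x)) =
        (\<lambda>x. x * normal_density 0 \<sigma> x * indicator {- t..} x)"
    using False by (auto simp: beyond_def split: split_indicator)
  then show ?thesis
    using False normal_density_tail_moment[OF assms, of "- t"]
    by (subst lborel_has_bochner_integral_real_affine_iff[of "-1" _ _ 0]) (simp_all only:, simp_all add: even)
qed

text \<open>
  The fundamental theorem of calculus for both signs of \<open>x\<close> at once: the sign of the oriented
  integral from \<open>0\<close> to \<open>x\<close> is absorbed by turning \<open>x\<close> into its absolute value.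
\<close>

lemma integral_derivative_beyond:
  fixes f f' :: "real \<Rightarrow> real"
  assumes f: "\<And>x. (f has_real_derivative f' x) (at x)"
    and cont: "continuous_on UNIV f'"
  shows "(\<integral>t. \<bar>x\<bar> * (f' t * indicator (beyond t) x) \<partial>lborel) = x * (f x - f 0)"
proof -
  have isCont: "isCont f' t" for t
    using cont by (simp add: continuous_on_eq_continuous_at)
  have FTC: "(\<integral>t. f' t * indicator {a..b} t \<partial>lborel) = f b - f a" if "a \<le> b" for a b
    using that f isCont by (intro integral_FTC_Icc_real) auto
  have [measurable]: "f' \<in> borel_measurable borel"
    using cont by (rule borel_measurable_continuous_onI)
  show ?thesis
  proof (cases "0 \<le> x")
    case True
    have "indicator (beyond t) x = (indicator {0..x} t :: real)" if "x \<noteq> 0" for t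
      using True that by (auto simp: beyond_def indicator_def)
    then show ?thesis
      using FTC[OF True] True by (cases "x = 0") auto
  next
    case False
    \<comment> \<open>The point \<open>t = 0\<close> is the only one where the two indicators differ.\<close>
    have "AE t in lborel. f' t * indicator (beyond t) x = f' t * indicator {x..0} t"
      using AE_lborel_singleton[of "0::real"]
      by eventually_elim (use False in \<open>auto simp: beyond_def indicator_def\<close>)
    moreover have "(\<lambda>t. f' t * indicator (beyond t) x) \<in> borel_measurable lborel"
      unfolding indicator_beyond by measurable
    ultimately have "(\<integral>t. f' t * indicator (beyond t) x \<partial>lborel) = f 0 - f x"
      using FTC[of x 0] False
      by (subst integral_cong_AE[where g = "\<lambda>t. f' t * indicator {x..0} t"]) auto
    then have "(\<integral>t. \<bar>x\<bar> * (f' t * indicator (beyond t) x) \<partial>lborel) = \<bar>x\<bar> * (f 0 - f x)"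
      by simp
    then show ?thesis
      using False by (simp only: abs_of_neg not_le) (simp add: algebra_simps)
  qed
qed

text \<open>
  Fubini's theorem for the kernel $\varphi(x) |x| f'(t)$ restricted to \<open>x\<close> beyond \<open>t\<close>. Integrating
  over \<open>x\<close> first gives $\sigma^2 \varphi(t) f'(t)$, by assumption an integrable function, so the
  kernel is integrable on the plane; integrating over \<open>t\<close> first gives
  $\varphi(x) x (f(x) - f(0))$, and the constant $f(0)$ contributes nothing since the mean is zero.
\<close>

lemma gauss_stein:
  fixes f f' :: "real \<Rightarrow> real"
  assumes \<sigma>: "\<sigma> > 0"
    and f: "\<And>x. (f has_real_derivative f' x) (at x)"
    and cont: "continuous_on UNIV f'"
    and int: "integrable lborel (\<lambda>x. normal_density 0 \<sigma> x * f' x)"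
  shows "has_bochner_integral lborel (\<lambda>x. normal_density 0 \<sigma> x * (x * f x))
           (\<sigma>\<^sup>2 * (\<integral>x. normal_density 0 \<sigma> x * f' x \<partial>lborel))"
proof -
  let ?\<phi> = "normal_density 0 \<sigma>"
  define K where "K t x = ?\<phi> x * \<bar>x\<bar> * (f' t * indicator (beyond t) x)" for t x
  have [measurable]: "f' \<in> borel_measurable borel"
    using cont by (rule borel_measurable_continuous_onI)
  have K_meas: "case_prod K \<in> borel_measurable (lborel \<Otimes>\<^sub>M lborel)"
    unfolding K_def indicator_beyond by measurable
  have K_x: "has_bochner_integral lborel (\<lambda>x. K t x) (\<sigma>\<^sup>2 * (?\<phi> t * f' t))"
    and K_x_abs: "(\<integral>x. norm (K t x) \<partial>lborel) = \<sigma>\<^sup>2 * \<bar>?\<phi> t * f' t\<bar>" for t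
  proof -
    have B: "has_bochner_integral lborel (\<lambda>x. ?\<phi> x * \<bar>x\<bar> * indicator (beyond t) x * c)
               (\<sigma>\<^sup>2 * ?\<phi> t * c)" for c
      using normal_density_mass_beyond[OF \<sigma>] by (rule has_bochner_integral_mult_left)
    show "has_bochner_integral lborel (\<lambda>x. K t x) (\<sigma>\<^sup>2 * (?\<phi> t * f' t))"
      using B[of "f' t"] by (simp add: K_def ac_simps)
    show "(\<integral>x. norm (K t x) \<partial>lborel) = \<sigma>\<^sup>2 * \<bar>?\<phi> t * f' t\<bar>"
      using has_bochner_integral_integral_eq[OF B[of "\<bar>f' t\<bar>"]]
      by (simp add: K_def abs_mult ac_simps)
  qed
  have K_int: "integrable (lborel \<Otimes>\<^sub>M lborel) (case_prod K)"
  proof (rule lborel_pair.Fubini_integrable[OF K_meas])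
    show "integrable lborel (\<lambda>t. \<integral>x. norm (case_prod K (t, x)) \<partial>lborel)"
      unfolding case_prod_conv K_x_abs using int by simp
    show "AE t in lborel. integrable lborel (\<lambda>x. case_prod K (t, x))"
      using K_x by (auto simp: has_bochner_integral_iff)
  qed
  have K_t: "(\<integral>t. K t x \<partial>lborel) = ?\<phi> x * (x * (f x - f 0))" for x
    using integral_derivative_beyond[OF f cont, of x] by (simp add: K_def mult.assoc)
  have "has_bochner_integral lborel (\<lambda>x. ?\<phi> x * (x * (f x - f 0)))
          (\<sigma>\<^sup>2 * (\<integral>t. ?\<phi> t * f' t \<partial>lborel))"
    using lborel_pair.integrable_snd[OF K_int] lborel_pair.Fubini_integral[OF K_int]
    by (simp add: has_bochner_integral_iff K_t has_bochner_integral_integral_eq[OF K_x])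
  from has_bochner_integral_add[OF this
      has_bochner_integral_mult_left[of "f 0", OF normal_moment_nz_1[OF \<sigma>, of 0]]]
  show ?thesis
    by (simp add: algebra_simps)
qed

section \<open>Polynomial weights\<close>

text \<open>Away from the unit interval lower powers are dominated by higher ones, and on it the
  integrand is continuous.\<close>

lemma gauss_integrable_lower_power:
  fixes f :: "real \<Rightarrow> real"
  assumes \<sigma>: "\<sigma> > 0"
    and cont: "continuous_on UNIV f"
    and int: "integrable lborel (\<lambda>x. normal_density 0 \<sigma> x * (x ^ n * f x))"
    and "k \<le> n"
  shows "integrable lborel (\<lambda>x. normal_density 0 \<sigma> x * (x ^ k * f x))"
proof -
  let ?\<phi> = "normal_density 0 \<sigma>"
  have [measurable]: "f \<in> borel_measurable borel"
    using cont by (rule borel_measurable_continuous_onI)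
  have c: "continuous_on {-1..1} (\<lambda>x. ?\<phi> x * (x ^ k * f x))"
    unfolding normal_density_def using \<sigma>
    by (intro continuous_intros continuous_on_subset[OF cont]) auto
  have "integrable lborel (\<lambda>x. indicator {-1..1} x *\<^sub>R (?\<phi> x * (x ^ k * f x)))"
    by (rule borel_integrable_compact[OF _ c]) simp
  then have "integrable lborel (\<lambda>x. \<bar>indicator {-1..1} x *\<^sub>R (?\<phi> x * (x ^ k * f x))\<bar> +
      \<bar>?\<phi> x * (x ^ n * f x)\<bar>)"
    using int by (intro Bochner_Integration.integrable_add integrable_abs)
  then show ?thesis
  proof (rule Bochner_Integration.integrable_bound)
    show "AE x in lborel. norm (?\<phi> x * (x ^ k * f x)) \<le>
        norm (\<bar>indicator {-1..1} x *\<^sub>R (?\<phi> x * (x ^ k * f x))\<bar> + \<bar>?\<phi> x * (x ^ n * f x)\<bar>)"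
    proof (rule AE_I2)
      fix x :: real
      have "\<bar>?\<phi> x * (x ^ k * f x)\<bar> \<le> \<bar>?\<phi> x * (x ^ n * f x)\<bar>" if "\<not> \<bar>x\<bar> \<le> 1"
        using that \<open>k \<le> n\<close>
        by (auto simp: abs_mult power_abs intro!: mult_mono power_increasing)
      then show "norm (?\<phi> x * (x ^ k * f x)) \<le>
        norm (\<bar>indicator {-1..1} x *\<^sub>R (?\<phi> x * (x ^ k * f x))\<bar> + \<bar>?\<phi> x * (x ^ n * f x)\<bar>)"
        by (auto simp: indicator_def abs_le_iff)
    qed
  qed measurable
qed

lemma gauss_stein_power_step:
  fixes f f' :: "real \<Rightarrow> real"
  assumes \<sigma>: "\<sigma> > 0"
    and f: "\<And>x. (f has_real_derivative f' x) (at x)"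
    and cont: "continuous_on UNIV f'"
    and int': "integrable lborel (\<lambda>x. normal_density 0 \<sigma> x * (x ^ k * f' x))"
    and int: "integrable lborel (\<lambda>x. normal_density 0 \<sigma> x * (x ^ (k - 1) * f x))"
  shows "has_bochner_integral lborel (\<lambda>x. normal_density 0 \<sigma> x * (x ^ Suc k * f x))
     (\<sigma>\<^sup>2 * ((\<integral>x. normal_density 0 \<sigma> x * (x ^ k * f' x) \<partial>lborel) +
            real k * (\<integral>x. normal_density 0 \<sigma> x * (x ^ (k - 1) * f x) \<partial>lborel)))"
proof -
  let ?\<phi> = "normal_density 0 \<sigma>"
  have fc: "continuous_on UNIV f"
    by (intro continuous_at_imp_continuous_on ballI DERIV_isCont[OF f])
  have eq: "?\<phi> x * (x ^ k * f' x + real k * x ^ (k - 1) * f x) =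
            ?\<phi> x * (x ^ k * f' x) + real k * (?\<phi> x * (x ^ (k - 1) * f x))" for x
    by (simp add: algebra_simps)
  have "has_bochner_integral lborel (\<lambda>x. ?\<phi> x * (x * (x ^ k * f x)))
      (\<sigma>\<^sup>2 * (\<integral>x. ?\<phi> x * (x ^ k * f' x + real k * x ^ (k - 1) * f x) \<partial>lborel))"
  proof (rule gauss_stein[OF \<sigma>])
    show "((\<lambda>x. x ^ k * f x) has_real_derivative
            x ^ k * f' x + real k * x ^ (k - 1) * f x) (at x)" for x
      using f[of x] by (auto intro!: derivative_eq_intros)
    show "continuous_on UNIV (\<lambda>x. x ^ k * f' x + real k * x ^ (k - 1) * f x)"
      using cont fc by (intro continuous_intros)
    show "integrable lborel (\<lambda>x. ?\<phi> x * (x ^ k * f' x + real k * x ^ (k - 1) * f x))"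
      unfolding eq using int' int by simp
  qed
  moreover have "(\<integral>x. ?\<phi> x * (x ^ k * f' x + real k * x ^ (k - 1) * f x) \<partial>lborel) =
      (\<integral>x. ?\<phi> x * (x ^ k * f' x) \<partial>lborel) +
      real k * (\<integral>x. ?\<phi> x * (x ^ (k - 1) * f x) \<partial>lborel)"
    unfolding eq using int' int by simp
  ultimately show ?thesis
    by (simp only: power_Suc mult.assoc)
qed

text \<open>
  The lower-order term $X^{k-1} f(X)$ is integrable by induction: the integrability of $X^k f'(X)$
  passes to $X^{k-1} f'(X)$, the identity for $k - 1$ turns this into that of $X^k f(X)$, and hence
  $X^{k-1} f(X)$ is integrable as well.
\<close>

lemma gauss_stein_power:
  fixes f f' :: "real \<Rightarrow> real"
  assumes \<sigma>: "\<sigma> > 0"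
    and f: "\<And>x. (f has_real_derivative f' x) (at x)"
    and cont: "continuous_on UNIV f'"
    and int: "integrable lborel (\<lambda>x. normal_density 0 \<sigma> x * (x ^ k * f' x))"
  shows "has_bochner_integral lborel (\<lambda>x. normal_density 0 \<sigma> x * (x ^ Suc k * f x))
     (\<sigma>\<^sup>2 * ((\<integral>x. normal_density 0 \<sigma> x * (x ^ k * f' x) \<partial>lborel) +
            real k * (\<integral>x. normal_density 0 \<sigma> x * (x ^ (k - 1) * f x) \<partial>lborel)))"
proof (rule gauss_stein_power_step[OF \<sigma> f cont int])
  have fc: "continuous_on UNIV f"
    by (intro continuous_at_imp_continuous_on ballI DERIV_isCont[OF f])
  show "integrable lborel (\<lambda>x. normal_density 0 \<sigma> x * (x ^ (k - 1) * f x))"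
    using int
  proof (induction k)
    case 0
    then have "has_bochner_integral lborel (\<lambda>x. normal_density 0 \<sigma> x * (x * f x))
        (\<sigma>\<^sup>2 * (\<integral>x. normal_density 0 \<sigma> x * f' x \<partial>lborel))"
      by (intro gauss_stein[OF \<sigma> f cont]) simp
    then show ?case
      using gauss_integrable_lower_power[OF \<sigma> fc, of 1 0] by (auto simp: has_bochner_integral_iff)
  next
    case (Suc k)
    have int_k: "integrable lborel (\<lambda>x. normal_density 0 \<sigma> x * (x ^ k * f' x))"
      by (rule gauss_integrable_lower_power[OF \<sigma> cont Suc.prems]) simp
    from gauss_stein_power_step[OF \<sigma> f cont int_k Suc.IH[OF int_k]]
    show ?case
      using gauss_integrable_lower_power[OF \<sigma> fc, of "Suc k" k] by (auto simp: has_bochner_integral_iff)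
  qed
qed

section \<open>The moment formula\<close>

lemma C_n_Suc_iff: "C_n (Suc n) g \<longleftrightarrow> g differentiable_on UNIV \<and> C_n n (deriv g)"
  by (auto simp: C_n_def All_less_Suc2 funpow_Suc_right simp del: funpow.simps)

lemma C_n_imp_continuous_on: "C_n n g \<Longrightarrow> continuous_on UNIV g"
  by (cases n) (auto simp: C_n_Suc_iff C_n_def[of 0] differentiable_imp_continuous_on)

lemma C_n_mono:
  assumes "C_n n g" "m \<le> n"
  shows "C_n m g"
  using assms
proof (induction m arbitrary: n g)
  case 0
  then show ?case by (auto simp: C_n_def[of 0] intro: C_n_imp_continuous_on)
next
  case (Suc m)
  then show ?case by (cases n) (auto simp: C_n_Suc_iff)
qed

lemma C_n_continuous_on_higher_deriv:
  assumes "C_n n g" "j \<le> n"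
  shows "continuous_on UNIV ((deriv ^^ j) g)"
  using C_n_mono[OF assms] by (simp add: C_n_def)

lemma C_n_has_real_derivative:
  assumes "C_n (Suc n) g"
  shows "(g has_real_derivative deriv g x) (at x)"
  using assms by (simp add: C_n_Suc_iff differentiable_on_def DERIV_deriv_iff_real_differentiable)

text \<open>Stein's identity makes \<open>X g(X)\<close> integrable, and \<open>g(X)\<close> is then a lower power.\<close>

lemma gauss_integrable_deriv_imp_integrable:
  assumes \<sigma>: "\<sigma> > 0"
    and g: "C_n (Suc n) g"
    and int: "integrable lborel (\<lambda>x. normal_density 0 \<sigma> x * deriv g x)"
  shows "integrable lborel (\<lambda>x. normal_density 0 \<sigma> x * g x)"
proof -
  have "continuous_on UNIV (deriv g)"
    using g C_n_imp_continuous_on by (auto simp: C_n_Suc_iff)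
  from gauss_stein_power[OF \<sigma> C_n_has_real_derivative[OF g] this, of 0] int
  show ?thesis
    using gauss_integrable_lower_power[OF \<sigma> C_n_imp_continuous_on[OF g], of 1 0]
    by (auto simp: has_bochner_integral_iff)
qed

lemma gauss_integrable_higher_deriv_downward:
  assumes "\<sigma> > 0" "C_n n g" "j \<le> n"
    and "integrable lborel (\<lambda>x. normal_density 0 \<sigma> x * (deriv ^^ n) g x)"
  shows "integrable lborel (\<lambda>x. normal_density 0 \<sigma> x * (deriv ^^ j) g x)"
  using assms(2-4)
proof (induction n arbitrary: g j)
  case (Suc n)
  have IH: "integrable lborel (\<lambda>x. normal_density 0 \<sigma> x * (deriv ^^ i) (deriv g) x)" if "i \<le> n" for i
    using Suc.IH[of "deriv g" i] Suc.prems that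
    by (simp add: C_n_Suc_iff funpow_Suc_right del: funpow.simps)
  show ?case
  proof (cases j)
    case 0
    then show ?thesis
      using gauss_integrable_deriv_imp_integrable[OF assms(1) Suc.prems(1)] IH[of 0] by simp
  next
    case (Suc i)
    then show ?thesis
      using IH[of i] \<open>j \<le> Suc n\<close> by (simp add: funpow_Suc_right del: funpow.simps)
  qed
qed simp

text \<open>
  The function is generalised in the induction because the recursion passes from \<open>g\<close> to its
  derivative. The sequence fed to \<open>hermite_sum_rec\<close> is $\sigma^{2(n+2-k)} E[g^{(n+2-2k)}(X)]$;
  reading it relative to $g'$ and $n + 1$, or shifted by one relative to \<open>g\<close> and \<open>n\<close>, splits off
  one factor $\sigma^2$ in both cases.
\<close>

lemma gauss_moment_formula:
  assumes \<sigma>: "\<sigma> > 0"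
    and "C_n n g"
    and "integrable lborel (\<lambda>x. normal_density 0 \<sigma> x * (deriv ^^ n) g x)"
  shows "has_bochner_integral lborel (\<lambda>x. normal_density 0 \<sigma> x * (x ^ n * g x))
     (\<Sum>k = 0..n div 2. H n k * \<sigma> ^ (2 * (n - k)) *
        (\<integral>x. normal_density 0 \<sigma> x * (deriv ^^ (n - 2 * k)) g x \<partial>lborel))"
  using assms(2-3)
proof (induction n arbitrary: g rule: induct_nat_012)
  case 0
  then show ?case by (simp add: has_bochner_integral_iff)
next
  case 1
  then have "continuous_on UNIV (deriv g)"
    using C_n_imp_continuous_on by (auto simp: C_n_Suc_iff)
  from gauss_stein_power[OF \<sigma> C_n_has_real_derivative[OF 1(1)] this, of 0] 1(2)
  show ?case by simp
next
  case (ge2 n)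
  let ?E = "\<lambda>h. \<integral>x. normal_density 0 \<sigma> x * h x \<partial>lborel"
  let ?S = "\<lambda>m h. \<Sum>k = 0..m div 2. H m k * \<sigma> ^ (2 * (m - k)) * ?E ((deriv ^^ (m - 2 * k)) h)"
  note g = ge2.prems(1)
  have g': "C_n (Suc n) (deriv g)"
    using g by (simp add: C_n_Suc_iff[of "Suc n"])
  have IH1: "has_bochner_integral lborel (\<lambda>x. normal_density 0 \<sigma> x * (x ^ Suc n * deriv g x))
      (?S (Suc n) (deriv g))"
    using ge2.prems(2) by (intro ge2.IH(2) g') (simp add: funpow_Suc_right del: funpow.simps)
  have IH0: "has_bochner_integral lborel (\<lambda>x. normal_density 0 \<sigma> x * (x ^ n * g x)) (?S n g)"
    by (rule ge2.IH(1)[OF C_n_mono[OF g]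
          gauss_integrable_higher_deriv_downward[OF \<sigma> g _ ge2.prems(2)]]) auto
  have "has_bochner_integral lborel (\<lambda>x. normal_density 0 \<sigma> x * (x ^ Suc (Suc n) * g x))
      (\<sigma>\<^sup>2 * (?S (Suc n) (deriv g) + real (Suc n) * ?S n g))"
    using gauss_stein_power[OF \<sigma> C_n_has_real_derivative[OF g] C_n_imp_continuous_on[OF g'],
        of "Suc n"] IH1 IH0
    by (simp only: has_bochner_integral_iff diff_Suc_1)
  also have "\<sigma>\<^sup>2 * (?S (Suc n) (deriv g) + real (Suc n) * ?S n g) = ?S (Suc (Suc n)) g"
  proof -
    define a where "a k = \<sigma> ^ (2 * (Suc (Suc n) - k)) * ?E ((deriv ^^ (Suc (Suc n) - 2 * k)) g)" for k
    have "\<sigma>\<^sup>2 * ?S (Suc n) (deriv g) = (\<Sum>k = 0..Suc n div 2. H (Suc n) k * a k)"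
      unfolding sum_distrib_left
    proof (intro sum.cong refl)
      fix k assume "k \<in> {0..Suc n div 2}"
      then have "Suc (Suc n) - 2 * k = Suc (Suc n - 2 * k)" "Suc (Suc n) - k = Suc (Suc n - k)"
        by auto
      then show "\<sigma>\<^sup>2 * (H (Suc n) k * \<sigma> ^ (2 * (Suc n - k)) *
            ?E ((deriv ^^ (Suc n - 2 * k)) (deriv g))) = H (Suc n) k * a k"
        by (simp add: a_def funpow_Suc_right power2_eq_square del: funpow.simps)
    qed
    moreover have "\<sigma>\<^sup>2 * ?S n g = (\<Sum>k = 0..n div 2. H n k * a (Suc k))"
      unfolding sum_distrib_left
    proof (intro sum.cong refl)
      fix k assume "k \<in> {0..n div 2}"
      then have "Suc (Suc n) - 2 * Suc k = n - 2 * k" "Suc (Suc n) - Suc k = Suc (n - k)"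
        by auto
      then show "\<sigma>\<^sup>2 * (H n k * \<sigma> ^ (2 * (n - k)) * ?E ((deriv ^^ (n - 2 * k)) g)) =
          H n k * a (Suc k)"
        by (simp add: a_def power2_eq_square)
    qed
    moreover have "?S (Suc (Suc n)) g = (\<Sum>k = 0..Suc (Suc n) div 2. H (Suc (Suc n)) k * a k)"
      by (simp only: a_def mult.assoc)
    ultimately show ?thesis
      unfolding hermite_sum_rec by (simp only: distrib_left mult.left_commute)
  qed
  finally show ?case .
qed

theorem theorem1:
  fixes M :: "'a measure" and X :: "'a \<Rightarrow> real" and \<sigma> :: real
    and n :: nat and g :: "real \<Rightarrow> real"
  assumes "prob_space M"
    and "\<sigma> > 0"
    and "distributed M lborel X (normal_density 0 \<sigma>)"
    and "C_n n g"
    and "integrable M (\<lambda>\<omega>. g (X \<omega>) * X \<omega> ^ n)"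
    and "\<And>k. k \<le> n div 2 \<Longrightarrow> integrable M (\<lambda>\<omega>. (deriv ^^ (n - 2 * k)) g (X \<omega>))"
  shows "(\<integral>\<omega>. g (X \<omega>) * X \<omega> ^ n \<partial>M) =
           (\<Sum>k = 0..n div 2. H n k * \<sigma> ^ (2 * (n - k)) *
              (\<integral>\<omega>. (deriv ^^ (n - 2 * k)) g (X \<omega>) \<partial>M))
         \<and> (\<forall>x. poly (He n) x = (\<Sum>k = 0..n div 2. (-1) ^ k * H n k * x ^ (n - 2 * k)))
         \<and> (\<forall>k \<le> n div 2. H n k = \<bar>coeff (He n) (n - 2 * k)\<bar>)"
proof (intro conjI allI impI)
  have meas [measurable]: "(deriv ^^ j) g \<in> borel_measurable borel" if "j \<le> n" for j
    using C_n_continuous_on_higher_deriv[OF assms(4) that] by (rule borel_measurable_continuous_onI)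
  have [measurable]: "g \<in> borel_measurable borel"
    using meas[of 0] by simp
  have E: "(\<integral>x. normal_density 0 \<sigma> x * h x \<partial>lborel) = (\<integral>\<omega>. h (X \<omega>) \<partial>M)"
    if "h \<in> borel_measurable borel" for h :: "real \<Rightarrow> real"
    using that distributed_integral[OF assms(3)] by simp
  have "integrable lborel (\<lambda>x. normal_density 0 \<sigma> x * (deriv ^^ n) g x)"
    using assms(6)[of 0] meas[of n] distributed_integrable[OF assms(3)] by simp
  from has_bochner_integral_integral_eq[OF gauss_moment_formula[OF assms(2,4) this]]
  have "(\<integral>\<omega>. X \<omega> ^ n * g (X \<omega>) \<partial>M) =
      (\<Sum>k = 0..n div 2. H n k * \<sigma> ^ (2 * (n - k)) *
        (\<integral>x. normal_density 0 \<sigma> x * (deriv ^^ (n - 2 * k)) g x \<partial>lborel))"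
    by (subst (asm) E) auto
  also have "\<dots> = (\<Sum>k = 0..n div 2. H n k * \<sigma> ^ (2 * (n - k)) *
        (\<integral>\<omega>. (deriv ^^ (n - 2 * k)) g (X \<omega>) \<partial>M))"
    by (intro sum.cong refl) (simp add: E meas)
  finally show "(\<integral>\<omega>. g (X \<omega>) * X \<omega> ^ n \<partial>M) =
      (\<Sum>k = 0..n div 2. H n k * \<sigma> ^ (2 * (n - k)) *
        (\<integral>\<omega>. (deriv ^^ (n - 2 * k)) g (X \<omega>) \<partial>M))"
    by (simp add: mult.commute)
next
  show "poly (He n) x = (\<Sum>k = 0..n div 2. (-1) ^ k * H n k * x ^ (n - 2 * k))" for x
    by (rule poly_He)
next
  fix k assume "k \<le> n div 2"
  moreover have "H n k \<ge> 0"
    by (simp add: H_def)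
  ultimately show "H n k = \<bar>coeff (He n) (n - 2 * k)\<bar>"
    by (simp add: coeff_He abs_mult)
qed

end
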